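(* Let $A\in\mathbb{R}^{n\times n}$ be symmetric positive definite with spectral decomposition $A=V\Lambda V^T+V_\perp\Lambda_\perp V_\perp^T$, where $(V,V_\perp)$ is an orthogonal matrix, $V\in\mathbb{R}^{n\times r}$, $\Lambda=\mathrm{diag}(\lambda_1,\dots,\lambda_r)$, $\Lambda_\perp=\mathrm{diag}(\lambda_{r+1},\dots,\lambda_n)$, $1\le r<n$, and every diagonal entry of $\Lambda$ is at most every diagonal entry of $\Lambda_\perp$. Let $Z\in\mathbb{R}^{n\times r}$ have orthonormal columns, let $E=Z^TAZ$, and let $P_A=I-AZE^{-1}Z^T+ZE^{-1}Z^T$. Let $\theta$ be the acute angle between $\mathcal{Z}=\mathrm{span}(Z)$ and $\mathcal{V}=\mathrm{span}(V)$. If $\cos\theta\neq0$, then the eigenvalues of $P_AA$ satisfy $$\min\{1,\lambda_{\min}(\Lambda_\perp)-\epsilon_D\}\le\lambda(P_AA)\le\max\{1,\lambda_{\max}(\Lambda_\perp)+\eta_D\},$$ where $\eta_D=\lambda_{\max}(\Lambda_\perp)(\sin\theta+\sin^2\theta)$ and $\epsilon_D=\eta_D+\|E^{-1}\|_2\left(\|E\|_2+\lambda_{\max}(\Lambda_\perp)\right)^2\tan^2\theta$.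
   Context: For two subspaces $\mathcal{Z},\mathcal{V}\subset\mathbb{R}^n$ of the same dimension $r$ with orthonormal bases given by the columns of $Z$ and $V$, $\mathrm{dist}(\mathcal{Z},\mathcal{V})=\|ZZ^T-VV^T\|_2=\sigma_{\max}(Z^TV_\perp)\in[0,1]$, where the columns of $V_\perp$ form an orthonormal basis of $\mathcal{V}^\perp$ and $\sigma_{\max}$ is the largest singular value. The acute angle between them is $\theta=\arcsin \mathrm{dist}(\mathcal{Z},\mathcal{V})\in[0,\pi/2]$. $\lambda_{\min},\lambda_{\max}$ denote smallest and largest eigenvalues, $\lambda(\cdot)$ an arbitrary eigenvalue, and $\|\cdot\|_2$ the spectral norm. *)

theory Defs
  imports "HOL-Analysis.Analysis"
begin

definition sym_pos_def :: "real^'n^'n \<Rightarrow> bool" where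
  "sym_pos_def A \<longleftrightarrow> transpose A = A \<and> (\<forall>x. x \<noteq> 0 \<longrightarrow> 0 < x \<bullet> (A *v x))"

definition diag_mat :: "real^'n \<Rightarrow> real^'n^'n" where
  "diag_mat d = (\<chi> i j. if i = j then d $ i else 0)"

definition orthonormal_columns :: "real^'r^'n \<Rightarrow> bool" where
  "orthonormal_columns Z \<longleftrightarrow> transpose Z ** Z = mat 1"

text \<open>The block matrix \<open>(V, W)\<close>; its columns are indexed by the disjoint sum of the two
  column index types.\<close>

definition hcat :: "real^'r^'n \<Rightarrow> real^'s^'n \<Rightarrow> real^('r + 's)^'n" where
  "hcat V W = (\<chi> i j. case j of Inl a \<Rightarrow> V $ i $ a | Inr b \<Rightarrow> W $ i $ b)"

text \<open>The library's \<^const>\<open>orthogonal_matrix\<close> requires the row and column index types to coincide.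
  Here they may differ, as for \<^const>\<open>hcat\<close>; the two equations force them to have the
  same cardinality.\<close>

definition orthogonal_mat :: "real^'m^'n \<Rightarrow> bool" where
  "orthogonal_mat Q \<longleftrightarrow> transpose Q ** Q = mat 1 \<and> Q ** transpose Q = mat 1"

definition eigenvalue :: "'a::field^'n^'n \<Rightarrow> 'a \<Rightarrow> bool" where
  "eigenvalue M \<mu> \<longleftrightarrow> (\<exists>v. v \<noteq> 0 \<and> M *v v = \<mu> *s v)"

definition lambda_min :: "real^'n^'n \<Rightarrow> real" where
  "lambda_min M = Min {\<mu>. eigenvalue M \<mu>}"

definition lambda_max :: "real^'n^'n \<Rightarrow> real" where
  "lambda_max M = Max {\<mu>. eigenvalue M \<mu>}"

definition spectral_norm :: "real^'m^'n \<Rightarrow> real" where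
  "spectral_norm M = onorm ((*v) M)"

text \<open>Distance and acute angle between the column spans of \<open>Z\<close> and \<open>V\<close>, both assumed to have
  orthonormal columns. By the lemma below, only the column spans matter.\<close>

definition subspace_dist :: "real^'r^'n \<Rightarrow> real^'r^'n \<Rightarrow> real" where
  "subspace_dist Z V = spectral_norm (Z ** transpose Z - V ** transpose V)"

definition acute_angle :: "real^'r^'n \<Rightarrow> real^'r^'n \<Rightarrow> real" where
  "acute_angle Z V = arcsin (subspace_dist Z V)"

lemma projection_depends_on_span:
  fixes Z :: "real^'r^'n" and W :: "real^'s^'n"
  assumes Z: "orthonormal_columns Z" and W: "orthonormal_columns W"
    and span: "span (columns Z) = span (columns W)"
  shows "Z ** transpose Z = W ** transpose W"
proof -
  have fix_cols: "X ** transpose X ** Y = Y"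
    if X: "orthonormal_columns X" and sub: "span (columns Y) \<subseteq> span (columns X)"
    for X :: "real^'a^'n" and Y :: "real^'b^'n"
  proof -
    have "X ** transpose X *v (Y *v u) = Y *v u" for u
    proof -
      have "Y *v u \<in> span (columns X)"
        using sub matrix_vector_mult_in_columnspace[of Y u] by blast
      also have "span (columns X) \<subseteq> range ((*v) X)"
      proof (rule span_minimal)
        show "columns X \<subseteq> range ((*v) X)"
          by (auto simp: columns_def simp flip: matrix_vector_mult_basis)
        show "subspace (range ((*v) X))"
          by (intro linear_subspace_image matrix_vector_mul_linear subspace_UNIV)
      qed
      finally obtain w where w: "Y *v u = X *v w" by blast
      have "X ** transpose X *v (X *v w) = X ** (transpose X ** X) *v w"
        by (simp add: matrix_vector_mul_assoc matrix_mul_assoc)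
      then show ?thesis
        using X w by (simp add: orthonormal_columns_def)
    qed
    then show ?thesis
      by (simp add: matrix_eq matrix_vector_mul_assoc[symmetric])
  qed
  let ?P = "Z ** transpose Z" and ?Q = "W ** transpose W"
  have PQ: "?P ** ?Q = ?Q" and QP: "?Q ** ?P = ?P"
    using fix_cols[OF Z, of W] fix_cols[OF W, of Z] span by (simp_all add: matrix_mul_assoc)
  have "?P = transpose (?Q ** ?P)"
    by (simp only: QP) (simp add: matrix_transpose_mul)
  also have "\<dots> = ?P ** ?Q"
    by (simp add: matrix_transpose_mul matrix_mul_assoc)
  finally show ?thesis using PQ by simp
qed

end

theory Submission
  imports Defs
begin

text \<open>
  Put \<open>M = P A\<close>, \<open>Q = 1 - Z Z\<^sup>T\<close> and \<open>S = A - A Z E\<^sup>-\<^sup>1 Z\<^sup>T A\<close>. Then \<open>S\<close> is symmetric, \<open>M Z = Z\<close>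
  and \<open>Q M = S Q\<close>, so \<open>Q\<close> sends an eigenvector of \<open>M\<close> either to \<open>0\<close> (and the eigenvalue is
  \<open>1\<close>) or to an eigenvector \<open>w\<close> of \<open>S\<close> orthogonal to the columns of \<open>Z\<close>. In the second case the
  eigenvalue is the Rayleigh quotient of \<open>S\<close> at \<open>w\<close>. It is at most \<open>\<lambda>\<^sub>m\<^sub>a\<^sub>x(A)\<close>, since the subtracted
  term is positive semidefinite. For the lower bound let \<open>s = sin \<theta>\<close>. As \<open>w\<close> is orthogonal to
  \<open>Z\<close>, its component along \<open>V\<close> has norm at most \<open>s |w|\<close>, so
  \<open>|Z\<^sup>T A w| \<le> (|\<Lambda>| + |\<Lambda>\<^sub>\<bottom>|) s |w|\<close>; finally \<open>|\<Lambda>| \<le> |E|\<close> because \<open>V\<^sup>T Z\<close> is invertible when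
  \<open>cos \<theta> \<noteq> 0\<close>.
\<close>

text \<open>As a simp rule this turns \<open>transpose M *v x\<close> into \<open>x v* M\<close>;
  all adjoint computations below rely on the form with \<open>transpose\<close>.\<close>

declare transpose_matrix_vector [simp del]

section \<open>Adjoints, the spectral norm and matrices with orthonormal columns\<close>

lemma inner_matrix_vector_mult_left:
  fixes M :: "real^'m^'n"
  shows "(M *v x) \<bullet> y = x \<bullet> (transpose M *v y)"
  by (metis dot_lmul_matrix inner_commute transpose_matrix_vector)

lemma transpose_minus: "transpose (M - N) = transpose M - transpose N"
  by (vector transpose_def)

lemma norm_matrix_vector_mult_le: "norm (M *v x) \<le> spectral_norm M * norm x"
  unfolding spectral_norm_def by (rule onorm) (rule matrix_vector_mul_bounded_linear)

lemma spectral_norm_nonneg: "0 \<le> spectral_norm M"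
  unfolding spectral_norm_def by (rule onorm_pos_le) (rule matrix_vector_mul_bounded_linear)

lemma orthonormal_columns_cancel:
  assumes "orthonormal_columns Z"
  shows "transpose Z *v (Z *v x) = x"
  using assms by (simp add: orthonormal_columns_def matrix_vector_mul_assoc)

lemma orthonormal_columns_norm:
  assumes "orthonormal_columns Z"
  shows "norm (Z *v x) = norm x"
  using assms
  by (simp add: norm_eq inner_matrix_vector_mult_left orthonormal_columns_cancel)

text \<open>Cauchy-Schwarz applied to
  \<open>|Z\<^sup>T x|\<^sup>2 = (Z Z\<^sup>T x) \<bullet> x\<close>, followed by cancelling one
  factor \<open>|Z\<^sup>T x|\<close>.\<close>

lemma norm_transpose_orthonormal_le:
  assumes "orthonormal_columns Z"
  shows "norm (transpose Z *v x) \<le> norm x"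
proof -
  let ?a = "transpose Z *v x"
  have "?a \<bullet> ?a = (Z *v ?a) \<bullet> x"
    by (simp add: inner_matrix_vector_mult_left)
  also have "\<dots> \<le> norm ?a * norm x"
    using norm_cauchy_schwarz[of "Z *v ?a" x] by (simp add: orthonormal_columns_norm assms)
  finally have "norm ?a * norm ?a \<le> norm ?a * norm x"
    by (simp add: norm_eq_sqrt_inner)
  then show ?thesis
    by (metis mult_le_cancel_left norm_ge_zero order.order_iff_strict linorder_not_le)
qed

section \<open>Diagonal matrices: spectrum, quadratic form and norm\<close>

lemma diag_mat_vector_mult: "diag_mat d *v x = (\<chi> i. d $ i * x $ i)"
  by (simp add: diag_mat_def matrix_vector_mult_def vec_eq_iff if_distrib[of "\<lambda>u. u * _"]
      cong: if_cong)

lemma diag_mat_axis: "diag_mat d *v axis i 1 = d $ i *\<^sub>R axis i 1"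
  by (simp add: diag_mat_vector_mult vec_eq_iff axis_def)

lemma eigenvalue_diag_mat: "eigenvalue (diag_mat d) \<mu> \<longleftrightarrow> \<mu> \<in> range (($) d)"
proof
  assume "eigenvalue (diag_mat d) \<mu>"
  then obtain v i where "v $ i \<noteq> 0" "d $ i * v $ i = \<mu> * v $ i"
    unfolding eigenvalue_def diag_mat_vector_mult vec_eq_iff by auto
  then show "\<mu> \<in> range (($) d)" by auto
next
  assume "\<mu> \<in> range (($) d)"
  then obtain i where "\<mu> = d $ i" by auto
  then have "diag_mat d *v axis i 1 = \<mu> *s axis i 1"
    by (simp add: diag_mat_axis scalar_mult_eq_scaleR)
  then show "eigenvalue (diag_mat d) \<mu>"
    unfolding eigenvalue_def by (metis axis_eq_0_iff zero_neq_one)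
qed

lemma lambda_max_diag_mat: "lambda_max (diag_mat d) = Max (range (($) d))"
  and lambda_min_diag_mat: "lambda_min (diag_mat d) = Min (range (($) d))"
  by (simp_all add: lambda_max_def lambda_min_def eigenvalue_diag_mat)

lemma inner_diag_mat_ge:
  assumes "\<And>i. c \<le> d $ i"
  shows "c * (x \<bullet> x) \<le> x \<bullet> (diag_mat d *v x)"
  using assms
  by (auto simp: diag_mat_vector_mult inner_vec_def sum_distrib_left mult.left_commute
      intro!: sum_mono mult_right_mono)

lemma inner_diag_mat_le:
  assumes "\<And>i. d $ i \<le> c"
  shows "x \<bullet> (diag_mat d *v x) \<le> c * (x \<bullet> x)"
  using assms
  by (auto simp: diag_mat_vector_mult inner_vec_def sum_distrib_left mult.left_commute
      intro!: sum_mono mult_right_mono)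

lemma norm_diag_mat_le:
  assumes "\<And>i. \<bar>d $ i\<bar> \<le> c"
  shows "norm (diag_mat d *v x) \<le> c * norm x"
proof -
  have "0 \<le> c" using assms[of undefined] by linarith
  have "norm (diag_mat d *v x) \<le> norm (c *\<^sub>R x)"
    using assms \<open>0 \<le> c\<close>
    by (intro norm_le_componentwise_cart)
      (simp add: diag_mat_vector_mult abs_mult mult_right_mono)
  then show ?thesis using \<open>0 \<le> c\<close> by simp
qed

text \<open>The first three facts are blocks of the equation for the columns; the last is the
  equation for the rows, with the sum over the disjoint index type split in two.\<close>

lemma hcat_orthogonal:
  fixes V :: "real^'b^'n" and W :: "real^'c^'n"
  assumes "orthogonal_mat (hcat V W)"
  shows "orthonormal_columns V" "orthonormal_columns W" "transpose V ** W = 0"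
    and "V ** transpose V + W ** transpose W = mat 1"
proof -
  have "(transpose (hcat V W) ** hcat V W) $ i $ j = mat 1 $ i $ j" for i j
    using assms by (simp add: orthogonal_mat_def)
  then have *: "(\<Sum>k\<in>UNIV. hcat V W $ k $ i * hcat V W $ k $ j) = (if i = j then 1 else 0)" for i j
    by (simp add: matrix_matrix_mult_def transpose_def mat_def)
  show "orthonormal_columns V"
    using *[of "Inl _" "Inl _"]
    by (simp add: orthonormal_columns_def hcat_def matrix_matrix_mult_def transpose_def mat_def)
  show "orthonormal_columns W"
    using *[of "Inr _" "Inr _"]
    by (simp add: orthonormal_columns_def hcat_def matrix_matrix_mult_def transpose_def mat_def)
  show "transpose V ** W = 0"
    using *[of "Inl _" "Inr _"]
    by (simp add: hcat_def matrix_matrix_mult_def transpose_def vec_eq_iff)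
  have "hcat V W ** transpose (hcat V W) = mat 1"
    using assms by (simp add: orthogonal_mat_def)
  moreover have "sum f UNIV = (\<Sum>k\<in>UNIV. f (Inl k)) + (\<Sum>k\<in>UNIV. f (Inr k))"
    for f :: "'b + 'c \<Rightarrow> real"
    using sum.Plus[of UNIV UNIV f] by simp
  then have "hcat V W ** transpose (hcat V W) = V ** transpose V + W ** transpose W"
    by (simp add: hcat_def matrix_matrix_mult_def transpose_def vec_eq_iff)
  ultimately show "V ** transpose V + W ** transpose W = mat 1" by simp
qed

section \<open>Positive definite matrices and inverses\<close>

lemma sym_pos_def_invertible:
  assumes "sym_pos_def A"
  shows "invertible A"
proof -
  have "x = 0" if "A *v x = 0" for x
    using assms that unfolding sym_pos_def_def by (metis inner_zero_right less_irrefl)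
  then show ?thesis
    by (simp add: invertible_left_inverse matrix_left_invertible_ker)
qed

lemma sym_pos_def_compression:
  assumes A: "sym_pos_def A" and Z: "orthonormal_columns Z"
  shows "sym_pos_def (transpose Z ** A ** Z)"
proof -
  have "0 < x \<bullet> ((transpose Z ** A ** Z) *v x)" if "x \<noteq> 0" for x
  proof -
    have "Z *v x \<noteq> 0"
      using that orthonormal_columns_norm[OF Z, of x] by auto
    then have "0 < (Z *v x) \<bullet> (A *v (Z *v x))"
      using A by (simp add: sym_pos_def_def)
    then show ?thesis
      by (simp add: inner_matrix_vector_mult_left matrix_vector_mul_assoc matrix_mul_assoc)
  qed
  moreover have "transpose (transpose Z ** A ** Z) = transpose Z ** A ** Z"
    using A by (simp add: sym_pos_def_def matrix_transpose_mul matrix_mul_assoc)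
  ultimately show ?thesis by (simp add: sym_pos_def_def)
qed

lemma matrix_inv_cancel:
  assumes "invertible E"
  shows "E ** matrix_inv E = mat 1" "matrix_inv E ** E = mat 1"
  using someI_ex[OF assms[unfolded invertible_def]] by (auto simp: matrix_inv_def)

section \<open>Orthogonal projections and the distance of subspaces\<close>

lemma projection_Pythagorean:
  assumes "orthonormal_columns X"
  shows "(norm (X *v (transpose X *v y)))\<^sup>2 + (norm (y - X *v (transpose X *v y)))\<^sup>2 = (norm y)\<^sup>2"
proof -
  let ?p = "X *v (transpose X *v y)"
  have "orthogonal ?p (y - ?p)"
    by (simp add: orthogonal_def inner_matrix_vector_mult_left matrix_vector_mult_diff_distrib
        orthonormal_columns_cancel[OF assms])
  then show ?thesis
    using norm_add_Pythagorean[of ?p "y - ?p"] by simp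
qed

text \<open>With \<open>p\<close>, \<open>q\<close> the two orthogonal projections, \<open>p - q = p (1 - q) - (1 - p) q\<close>, where the
  two summands have orthogonal ranges.\<close>

lemma subspace_dist_le_1:
  assumes Z: "orthonormal_columns Z" and V: "orthonormal_columns V"
  shows "subspace_dist Z V \<le> 1"
  unfolding subspace_dist_def spectral_norm_def
proof (rule onorm_le)
  fix x
  let ?p = "\<lambda>x. Z *v (transpose Z *v x)" and ?q = "\<lambda>x. V *v (transpose V *v x)"
  let ?u = "?p (x - ?q x)" and ?v = "?q x - ?p (?q x)"
  have "(Z ** transpose Z - V ** transpose V) *v x = ?u - ?v"
    by (simp add: matrix_vector_mult_diff_rdistrib matrix_vector_mul_assoc matrix_vector_mult_diff_distrib)
  moreover have "?u \<bullet> ?v = 0"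
    by (simp add: inner_diff inner_matrix_vector_mult_left orthonormal_columns_cancel[OF Z]
        matrix_vector_mult_diff_distrib)
  ultimately have "(norm ((Z ** transpose Z - V ** transpose V) *v x))\<^sup>2 = (norm ?u)\<^sup>2 + (norm ?v)\<^sup>2"
    by (simp add: power2_norm_eq_inner inner_diff inner_commute)
  also have "\<dots> \<le> (norm (x - ?q x))\<^sup>2 + (norm (?q x))\<^sup>2"
    using projection_Pythagorean[OF Z, of "x - ?q x"] projection_Pythagorean[OF Z, of "?q x"]
    by (smt (verit) zero_le_power2)
  also have "\<dots> = (norm x)\<^sup>2"
    using projection_Pythagorean[OF V, of x] by simp
  finally show "norm ((Z ** transpose Z - V ** transpose V) *v x) \<le> 1 * norm x"
    by (simp add: power2_le_iff_abs_le)
qed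

text \<open>On a vector orthogonal to the columns of \<open>Z\<close> the difference of the
  projections acts as \<open>- V V\<^sup>T\<close>.\<close>

lemma norm_transpose_le_subspace_dist:
  assumes V: "orthonormal_columns V" and w: "transpose Z *v w = 0"
  shows "norm (transpose V *v w) \<le> subspace_dist Z V * norm w"
proof -
  have "(Z ** transpose Z - V ** transpose V) *v w = - (V *v (transpose V *v w))"
    using w by (simp add: matrix_vector_mult_diff_rdistrib flip: matrix_vector_mul_assoc)
  then show ?thesis
    using norm_matrix_vector_mult_le[of "Z ** transpose Z - V ** transpose V" w]
    by (simp add: subspace_dist_def orthonormal_columns_norm[OF V])
qed

lemma subspace_dist_commute: "subspace_dist Z V = subspace_dist V Z"
proof -
  have "norm ((Z ** transpose Z - V ** transpose V) *v x)
    = norm ((V ** transpose V - Z ** transpose Z) *v x)" for x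
    by (simp add: matrix_vector_mult_diff_rdistrib norm_minus_commute)
  then show ?thesis
    by (simp add: subspace_dist_def spectral_norm_def onorm_def)
qed

section \<open>Real spectrum and reduction to a symmetric matrix\<close>

lemma eigenvalue_complex_of_real_matrix:
  fixes M :: "real^'n^'n"
  assumes "eigenvalue (map_matrix complex_of_real M) \<mu>"
  obtains x y where "x \<noteq> 0 \<or> y \<noteq> 0"
    and "M *v x = Re \<mu> *\<^sub>R x - Im \<mu> *\<^sub>R y" and "M *v y = Im \<mu> *\<^sub>R x + Re \<mu> *\<^sub>R y"
proof -
  obtain v where v: "v \<noteq> 0" "map_matrix complex_of_real M *v v = \<mu> *s v"
    using assms by (auto simp: eigenvalue_def)
  define x y where "x = (\<chi> i. Re (v $ i))" and "y = (\<chi> i. Im (v $ i))"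
  have *: "(\<Sum>j\<in>UNIV. complex_of_real (M $ i $ j) * v $ j) = \<mu> * v $ i" for i
    using v(2) by (simp add: vec_eq_iff matrix_vector_mult_def map_matrix_def)
  show ?thesis
  proof
    show "x \<noteq> 0 \<or> y \<noteq> 0"
      using v(1) by (auto simp: x_def y_def vec_eq_iff complex_eq_iff)
    show "M *v x = Re \<mu> *\<^sub>R x - Im \<mu> *\<^sub>R y"
      using arg_cong[OF *, of Re]
      by (simp add: x_def y_def vec_eq_iff matrix_vector_mult_def)
    show "M *v y = Im \<mu> *\<^sub>R x + Re \<mu> *\<^sub>R y"
      using arg_cong[OF *, of Im]
      by (simp add: x_def y_def vec_eq_iff matrix_vector_mult_def algebra_simps)
  qed
qed

text \<open>Evaluating \<open>(S *v w) \<bullet> u = w \<bullet> (S *v u)\<close> on both sides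
  leaves \<open>\<beta>\<close> times a positive number equal to zero.\<close>

lemma symmetric_rotation_zero:
  fixes S :: "real^'n^'n"
  assumes S: "transpose S = S"
    and w: "S *v w = \<alpha> *\<^sub>R w - \<beta> *\<^sub>R u" and u: "S *v u = \<beta> *\<^sub>R w + \<alpha> *\<^sub>R u"
    and nz: "w \<noteq> 0 \<or> u \<noteq> 0"
  shows "\<beta> = 0"
proof -
  have "(S *v w) \<bullet> u = w \<bullet> (S *v u)"
    by (simp add: inner_matrix_vector_mult_left S)
  then have "\<beta> * (w \<bullet> w + u \<bullet> u) = 0"
    by (simp add: w u inner_diff inner_add algebra_simps)
  moreover have "w \<bullet> w + u \<bullet> u \<noteq> 0"
    using nz by (auto simp: add_nonneg_eq_0_iff)
  ultimately show ?thesis by simp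
qed

text \<open>\<open>M\<close> need not be symmetric, so a complex eigenvector \<open>x + i y\<close>
  is considered. \<open>Q\<close> carries the relations between \<open>x\<close> and
  \<open>y\<close> over to the symmetric \<open>S\<close>, which forces the imaginary part of
  \<open>\<mu>\<close> to vanish.\<close>

lemma deflated_eigenvector:
  fixes A :: "real^'n^'n" and Z :: "real^'r^'n"
  defines "E \<equiv> transpose Z ** A ** Z"
  defines "M \<equiv> (mat 1 - A ** Z ** matrix_inv E ** transpose Z + Z ** matrix_inv E ** transpose Z) ** A"
  assumes A: "sym_pos_def A" and Z: "orthonormal_columns Z"
    and ev: "eigenvalue (map_matrix complex_of_real M) \<mu>"
  shows "\<mu> \<in> \<real>" (is ?R)
    and "\<mu> = 1 \<or> (\<exists>w. w \<noteq> 0 \<and> transpose Z *v w = 0 \<and>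
      A *v w - A *v (Z *v (matrix_inv E *v (transpose Z *v (A *v w)))) = Re \<mu> *\<^sub>R w)" (is ?D)
proof -
  define F where "F = matrix_inv E"
  define S where "S = A - A ** Z ** F ** transpose Z ** A"
  define Q where "Q = mat 1 - Z ** transpose Z"
  have E: "sym_pos_def E"
    unfolding E_def by (rule sym_pos_def_compression[OF A Z])
  have EF: "E ** F = mat 1" and FE: "F ** E = mat 1"
    unfolding F_def by (rule matrix_inv_cancel[OF sym_pos_def_invertible[OF E]])+
  \<comment> \<open>The inverse inherits symmetry:
    \<open>F\<^sup>T = F\<^sup>T E F = (E F)\<^sup>T F = F\<close>.\<close>
  have "transpose F = transpose F ** (E ** F)" by (simp add: EF)
  also have "\<dots> = transpose (E ** F) ** F"
    using E by (simp add: matrix_transpose_mul matrix_mul_assoc sym_pos_def_def)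
  finally have F: "transpose F = F" by (simp add: EF)
  have A': "transpose A = A" using A by (simp add: sym_pos_def_def)
  have S: "transpose S = S"
    by (simp add: S_def transpose_minus matrix_transpose_mul A' F matrix_mul_assoc)
  have Mx: "M *v x = S *v x + Z *v (F *v (transpose Z *v (A *v x)))" for x
    by (simp add: M_def S_def F_def matrix_vector_mult_diff_rdistrib matrix_vector_mult_add_rdistrib
        flip: matrix_vector_mul_assoc)
  have Sx: "S *v x = A *v x - A *v (Z *v (F *v (transpose Z *v (A *v x))))" for x
    by (simp add: S_def matrix_vector_mult_diff_rdistrib flip: matrix_vector_mul_assoc)
  have Ex: "transpose Z *v (A *v (Z *v y)) = E *v y" for y
    by (simp add: E_def flip: matrix_vector_mul_assoc)
  have EFx: "E *v (F *v y) = y" "F *v (E *v y) = y" for y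
    by (simp_all add: matrix_vector_mul_assoc EF FE)
  have ZS: "transpose Z *v (S *v x) = 0" for x
    by (simp add: Sx matrix_vector_mult_diff_distrib Ex EFx)
  have SZ: "S *v (Z *v y) = 0" for y
    by (simp add: Sx Ex EFx)
  have MZ: "M *v (Z *v y) = Z *v y" for y
    by (simp add: Mx SZ Ex EFx)
  have Qx: "Q *v x = x - Z *v (transpose Z *v x)" for x
    by (simp add: Q_def matrix_vector_mult_diff_rdistrib flip: matrix_vector_mul_assoc)
  have ZQ: "transpose Z *v (Q *v x) = 0" for x
    by (simp add: Qx matrix_vector_mult_diff_distrib orthonormal_columns_cancel[OF Z])
  \<comment> \<open>Both sides equal \<open>S *v x\<close>: \<open>S\<close> annihilates the range
    of \<open>Z\<close>, its own range is orthogonal to that range, and \<open>Q\<close> removes the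
    remaining term of \<open>M\<close>.\<close>
  have SQ: "S *v (Q *v x) = Q *v (M *v x)" for x
    by (simp add: Qx Mx matrix_vector_mult_diff_distrib matrix_vector_right_distrib SZ ZS
        orthonormal_columns_cancel[OF Z])
  obtain x y where xy: "x \<noteq> 0 \<or> y \<noteq> 0"
      "M *v x = Re \<mu> *\<^sub>R x - Im \<mu> *\<^sub>R y" "M *v y = Im \<mu> *\<^sub>R x + Re \<mu> *\<^sub>R y"
    using eigenvalue_complex_of_real_matrix[OF ev] by blast
  have Sw: "S *v (Q *v x) = Re \<mu> *\<^sub>R (Q *v x) - Im \<mu> *\<^sub>R (Q *v y)"
    and Su: "S *v (Q *v y) = Im \<mu> *\<^sub>R (Q *v x) + Re \<mu> *\<^sub>R (Q *v y)"
    by (simp_all add: SQ xy matrix_vector_mult_diff_distrib matrix_vector_right_distrib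
        matrix_vector_mult_scaleR)
  have "Im \<mu> = 0 \<and> ?D"
  proof (cases "Q *v x = 0 \<and> Q *v y = 0")
    case True
    then have "M *v x = x" "M *v y = y"
      using MZ by (metis Qx right_minus_eq)+
    \<comment> \<open>Here \<open>x\<close> and \<open>y\<close> lie in the range of
      \<open>Z\<close>, where \<open>M\<close> is the identity; writing \<open>mat 1\<close> lets
      the identity play the symmetric matrix.\<close>
    then have x: "mat 1 *v x = Re \<mu> *\<^sub>R x - Im \<mu> *\<^sub>R y" and y: "mat 1 *v y = Im \<mu> *\<^sub>R x + Re \<mu> *\<^sub>R y"
      using xy by simp_all
    then have im: "Im \<mu> = 0"
      using symmetric_rotation_zero[OF transpose_mat x y xy(1)] by simp
    then have "(1 - Re \<mu>) *\<^sub>R x = 0" "(1 - Re \<mu>) *\<^sub>R y = 0"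
      using x y by (simp_all add: algebra_simps)
    then have "Re \<mu> = 1" using xy(1) by auto
    then show ?thesis using im by (simp add: complex_eq_iff)
  next
    case False
    then have im: "Im \<mu> = 0"
      using symmetric_rotation_zero[OF S Sw Su] by blast
    then have "S *v (Q *v x) = Re \<mu> *\<^sub>R (Q *v x)" "S *v (Q *v y) = Re \<mu> *\<^sub>R (Q *v y)"
      using Sw Su by simp_all
    then show ?thesis
      using False im ZQ unfolding Sx F_def by blast
  qed
  then show ?R ?D by (auto simp: complex_is_Real_iff)
qed

theorem theorem3p6:
  fixes A :: "real^'n^'n"
    and V Z :: "real^'r^'n" and Vp :: "real^'s^'n"
    and lam :: "real^'r" and lamp :: "real^'s"
    and E :: "real^'r^'r" and P :: "real^'n^'n"
    and \<theta> \<eta> \<epsilon> :: real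
  assumes "sym_pos_def A"
    and "orthogonal_mat (hcat V Vp)"
    and "A = V ** diag_mat lam ** transpose V + Vp ** diag_mat lamp ** transpose Vp"
    and "\<forall>i j. lam $ i \<le> lamp $ j"
    and "orthonormal_columns Z"
    and "E = transpose Z ** A ** Z"
    and "P = mat 1 - A ** Z ** matrix_inv E ** transpose Z + Z ** matrix_inv E ** transpose Z"
    and "\<theta> = acute_angle Z V"
    and "cos \<theta> \<noteq> 0"
    and "\<eta> = lambda_max (diag_mat lamp) * (sin \<theta> + (sin \<theta>)\<^sup>2)"
    and "\<epsilon> = \<eta> + spectral_norm (matrix_inv E)
               * (spectral_norm E + lambda_max (diag_mat lamp))\<^sup>2 * (tan \<theta>)\<^sup>2"
  shows "\<forall>\<mu>::complex. eigenvalue (map_matrix complex_of_real (P ** A)) \<mu> \<longrightarrow>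
           \<mu> \<in> \<real> \<and>
           min 1 (lambda_min (diag_mat lamp) - \<epsilon>) \<le> Re \<mu> \<and>
           Re \<mu> \<le> max 1 (lambda_max (diag_mat lamp) + \<eta>)"
proof (intro allI impI)
  fix \<mu> assume ev: "eigenvalue (map_matrix complex_of_real (P ** A)) \<mu>"

  \<comment> \<open>The quadratic form of \<open>A\<close> in the coordinates given by
    \<open>V\<close> and \<open>Vp\<close>\<close>
  note A = assms(1) and Z = assms(5) and Aeq = assms(3)
  note V = hcat_orthogonal(1)[OF assms(2)] and Vp = hcat_orthogonal(2)[OF assms(2)]
  have VVp: "transpose V *v (Vp *v b) = 0" for b
    by (simp add: matrix_vector_mul_assoc hcat_orthogonal(3)[OF assms(2)])
  have split: "V *v (transpose V *v x) + Vp *v (transpose Vp *v x) = x" for x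
    using hcat_orthogonal(4)[OF assms(2)]
    by (simp add: matrix_vector_mul_assoc flip: matrix_vector_mult_add_rdistrib)
  have norm_split: "x \<bullet> x = (transpose V *v x) \<bullet> (transpose V *v x)
      + (transpose Vp *v x) \<bullet> (transpose Vp *v x)" for x
    using arg_cong[OF split, of "\<lambda>y. y \<bullet> x"]
    by (simp add: inner_add inner_matrix_vector_mult_left)
  have Ax: "A *v x = V *v (diag_mat lam *v (transpose V *v x))
      + Vp *v (diag_mat lamp *v (transpose Vp *v x))" for x
    by (simp add: Aeq matrix_vector_mult_add_rdistrib flip: matrix_vector_mul_assoc)
  have form: "x \<bullet> (A *v x) = (transpose V *v x) \<bullet> (diag_mat lam *v (transpose V *v x))
      + (transpose Vp *v x) \<bullet> (diag_mat lamp *v (transpose Vp *v x))" for x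
  proof -
    have "(A *v x) \<bullet> x = (diag_mat lam *v (transpose V *v x)) \<bullet> (transpose V *v x)
        + (diag_mat lamp *v (transpose Vp *v x)) \<bullet> (transpose Vp *v x)"
      unfolding Ax inner_add_left
      by (simp only: inner_matrix_vector_mult_left[of V] inner_matrix_vector_mult_left[of Vp])
    then show ?thesis by (simp only: inner_commute)
  qed
  define L l where "L = lambda_max (diag_mat lamp)" and "l = lambda_min (diag_mat lamp)"
  have L: "lamp $ j \<le> L" and l: "l \<le> lamp $ j" for j
    by (simp_all add: L_def l_def lambda_max_diag_mat lambda_min_diag_mat)
  have lam_pos: "0 < lam $ i" for i
  proof -
    let ?x = "V *v axis i 1"
    have "?x \<noteq> 0"
      using orthonormal_columns_norm[OF V, of "axis i 1"] by auto
    then have "0 < ?x \<bullet> (A *v ?x)"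
      using A by (simp add: sym_pos_def_def)
    \<comment> \<open>\<open>?x\<close> and its \<open>V\<close>-coordinates both have norm 1, so
      nothing is left for the \<open>Vp\<close>-coordinates.\<close>
    moreover have "transpose Vp *v ?x = 0"
      using norm_split[of ?x] orthonormal_columns_norm[OF V, of "axis i 1"]
      by (simp add: orthonormal_columns_cancel[OF V] norm_eq_1)
    ultimately show ?thesis
      by (simp add: form orthonormal_columns_cancel[OF V] diag_mat_axis inner_axis_axis)
  qed
  have lamp_pos: "0 < lamp $ j" for j
    using lam_pos assms(4) by (meson less_le_trans)
  have lamL: "lam $ i \<le> L" for i
    using assms(4) L by (meson order_trans)
  have lL: "l \<le> L" using l L by (rule order_trans)
  have L0: "0 < L" using lamp_pos L by (rule less_le_trans)

  \<comment> \<open>Sine, cosine and tangent of the angle\<close>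
  define s where "s = subspace_dist Z V"
  have s0: "0 \<le> s" by (simp add: s_def subspace_dist_def spectral_norm_nonneg)
  have s1: "s \<le> 1" using subspace_dist_le_1[OF Z V] by (simp add: s_def)
  have sin: "sin \<theta> = s"
    using s0 s1 by (simp add: assms(8) acute_angle_def s_def)
  have cos: "cos \<theta> = sqrt (1 - s\<^sup>2)"
    using s0 s1 by (simp add: assms(8) acute_angle_def s_def cos_arcsin)
  have s_lt: "s < 1"
    using assms(9) s1 cos by (cases "s = 1") auto
  have tan: "s \<le> tan \<theta>"
  proof -
    have "0 < cos \<theta>" "cos \<theta> \<le> 1"
      using assms(9) cos s0 s1 by (auto simp: abs_square_le_1 less_le)
    then show ?thesis
      using s0 by (simp add: tan_def sin field_simps mult_left_le)
  qed
  \<comment> \<open>The quantity \<open>L * s\<^sup>2\<close> is what the component along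
    \<open>V\<close> can cost in the lower bound for the Rayleigh quotient of
    \<open>A\<close>.\<close>
  have \<eta>: "L * s\<^sup>2 \<le> \<eta>"
    using L0 s0 by (simp add: assms(10) sin flip: L_def)
  then have \<eta>0: "0 \<le> \<eta>"
    using L0 by (smt (verit) mult_nonneg_nonneg zero_le_power2)
  have E: "sym_pos_def E"
    unfolding assms(6) by (rule sym_pos_def_compression[OF A Z])
  note EF = matrix_inv_cancel[OF sym_pos_def_invertible[OF E]]
  define F where "F = matrix_inv E"

  have lamE: "lam $ i \<le> spectral_norm E" for i
    \<comment> \<open>The span of \<open>Z\<close> contains an \<open>x\<close> with \<open>V\<^sup>T x = e\<^sub>i\<close>, whose Rayleigh quotient is a weighted
      mean of \<open>\<lambda>\<^sub>i\<close> and entries of \<open>\<Lambda>\<^sub>\<bottom>\<close>, hence at least \<open>\<lambda>\<^sub>i\<close>.\<close>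
  proof -
    \<comment> \<open>Such a \<open>Z *v x\<close> is orthogonal to the columns of \<open>V\<close>;
      the distance bound with \<open>Z\<close> and \<open>V\<close> exchanged gives
      \<open>|x| \<le> s |x|\<close> with \<open>s < 1\<close>.\<close>
    have "x = 0" if "(transpose V ** Z) *v x = 0" for x
    proof -
      have "norm (Z *v x) \<le> s * norm (Z *v x)"
        using norm_transpose_le_subspace_dist[OF Z, of V "Z *v x"] that
        by (simp add: s_def subspace_dist_commute[of V] orthonormal_columns_cancel[OF Z]
            orthonormal_columns_norm[OF Z] flip: matrix_vector_mul_assoc)
      then have "norm x * (1 - s) \<le> 0"
        by (simp add: orthonormal_columns_norm[OF Z] algebra_simps)
      then show ?thesis
        using s_lt by (simp add: mult_le_0_iff)
    qed
    then have "invertible (transpose V ** Z)"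
      by (simp add: invertible_left_inverse matrix_left_invertible_ker)
    then obtain y where y: "(transpose V ** Z) *v y = axis i 1"
      by (metis matrix_inv_cancel(1) matrix_vector_mul_assoc matrix_vector_mul_lid)
    define x where "x = Z *v y"
    have Vx: "transpose V *v x = axis i 1"
      using y by (simp add: x_def matrix_vector_mul_assoc)
    have "y \<noteq> 0" using y by auto
    have "lam $ i * (x \<bullet> x) \<le> x \<bullet> (A *v x)"
      using inner_diag_mat_ge[of "lam $ i" lamp "transpose Vp *v x"] assms(4)
      by (simp add: norm_split[of x] form Vx diag_mat_axis inner_axis_axis distrib_left)
    also have "\<dots> = y \<bullet> (E *v y)"
      by (simp add: x_def assms(6) inner_matrix_vector_mult_left flip: matrix_vector_mul_assoc)
    also have "\<dots> \<le> norm y * (spectral_norm E * norm y)"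
      using norm_cauchy_schwarz norm_matrix_vector_mult_le
      by (meson mult_left_mono norm_ge_zero order_trans)
    finally have "lam $ i * (norm y)\<^sup>2 \<le> spectral_norm E * (norm y)\<^sup>2"
      by (simp add: x_def orthonormal_columns_norm[OF Z] power2_eq_square mult_ac
          flip: power2_norm_eq_inner)
    then show ?thesis
      using \<open>y \<noteq> 0\<close> by (simp add: mult_le_cancel_right)
  qed

  note reduced = deflated_eigenvector[OF A Z, folded assms(6), folded assms(7), OF ev, folded F_def]
  have "l - \<epsilon> \<le> Re \<mu> \<and> Re \<mu> \<le> L + \<eta>" if not_1: "\<mu> \<noteq> 1"
  proof -
    obtain w where w0: "w \<noteq> 0" and Zw: "transpose Z *v w = 0"
      and Sw: "A *v w - A *v (Z *v (F *v (transpose Z *v (A *v w)))) = Re \<mu> *\<^sub>R w"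
      using reduced(2) not_1 by blast
    define a b g where "a = transpose V *v w" and "b = transpose Vp *v w"
      and "g = transpose Z *v (A *v w)"
    have ww: "0 < w \<bullet> w" using w0 by simp
    have "w \<bullet> (A *v (Z *v (F *v g))) = g \<bullet> (F *v g)"
      using A by (simp add: g_def sym_pos_def_def inner_matrix_vector_mult_left)
    then have \<mu>: "Re \<mu> * (w \<bullet> w) = w \<bullet> (A *v w) - g \<bullet> (F *v g)"
      using arg_cong[OF Sw, of "\<lambda>y. w \<bullet> y"] by (simp add: inner_diff g_def)
    \<comment> \<open>Substituting \<open>g = E *v ?h\<close> turns this into the quadratic form of
      \<open>E\<close>.\<close>
    have gFg_nonneg: "0 \<le> g \<bullet> (F *v g)"
    proof -
      let ?h = "F *v g"
      have "E *v ?h = g"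
        by (simp add: F_def EF matrix_vector_mul_assoc)
      then have "g \<bullet> ?h = ?h \<bullet> (E *v ?h)"
        by (simp only: inner_commute)
      moreover have "0 \<le> ?h \<bullet> (E *v ?h)"
        using E unfolding sym_pos_def_def by (cases "?h = 0") (auto intro: less_imp_le)
      ultimately show ?thesis by simp
    qed
    have a: "norm a \<le> s * norm w"
      unfolding a_def s_def by (rule norm_transpose_le_subspace_dist[OF V Zw])
    have b: "norm b \<le> norm w"
      unfolding b_def by (rule norm_transpose_orthonormal_le[OF Vp])

    \<comment> \<open>Upper bound for the Rayleigh quotient\<close>
    have "w \<bullet> (A *v w) \<le> L * (w \<bullet> w)"
      using inner_diag_mat_le[of lam L a] inner_diag_mat_le[of lamp L b] lamL L
      by (simp add: form norm_split[of w] distrib_left flip: a_def b_def)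
    then have "Re \<mu> * (w \<bullet> w) \<le> (L + \<eta>) * (w \<bullet> w)"
      using \<mu> gFg_nonneg mult_nonneg_nonneg[OF \<eta>0 less_imp_le[OF ww]]
      by (simp add: distrib_right)
    then have upper: "Re \<mu> \<le> L + \<eta>" using ww by simp

    \<comment> \<open>Lower bound for the Rayleigh quotient\<close>
    have "(l - \<eta>) * (w \<bullet> w) \<le> w \<bullet> (A *v w)"
    proof -
      \<comment> \<open>In \<open>l |w|\<^sup>2 = l |a|\<^sup>2 + l |b|\<^sup>2\<close> the first
        summand is at most \<open>\<eta> |w|\<^sup>2\<close>, and the second is at most the form of
        \<open>A\<close> at \<open>w\<close>.\<close>
      have "l * (a \<bullet> a) \<le> L * (a \<bullet> a)"
        using lL by (simp add: mult_right_mono)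
      also have "a \<bullet> a \<le> s\<^sup>2 * (w \<bullet> w)"
        using power_mono[OF a, of 2] by (simp add: power_mult_distrib power2_norm_eq_inner)
      then have "L * (a \<bullet> a) \<le> L * s\<^sup>2 * (w \<bullet> w)"
        using L0 by simp
      also have "\<dots> \<le> \<eta> * (w \<bullet> w)"
        using \<eta> ww by simp
      finally have "l * (w \<bullet> w) - \<eta> * (w \<bullet> w) \<le> l * (b \<bullet> b)"
        by (simp add: norm_split[of w] distrib_left flip: a_def b_def)
      moreover have "l * (b \<bullet> b) \<le> b \<bullet> (diag_mat lamp *v b)"
        by (rule inner_diag_mat_ge[OF l])
      moreover have "0 \<le> a \<bullet> (diag_mat lam *v a)"
        using inner_diag_mat_ge[of 0 lam a] lam_pos by (simp add: less_imp_le)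
      ultimately show ?thesis
        by (simp add: form left_diff_distrib flip: a_def b_def)
    qed
    moreover have "g \<bullet> (F *v g) \<le> (\<epsilon> - \<eta>) * (w \<bullet> w)"
    proof -
      let ?c = "spectral_norm E + L"
      have c0: "0 \<le> ?c" using L0 spectral_norm_nonneg[of E] by simp
      have "norm g \<le> norm (transpose Z *v (V *v (diag_mat lam *v a)))
          + norm (transpose Z *v (Vp *v (diag_mat lamp *v b)))"
        by (simp add: g_def a_def b_def Ax matrix_vector_right_distrib norm_triangle_ineq)
      moreover have "norm (transpose Z *v (V *v (diag_mat lam *v a))) \<le> spectral_norm E * (s * norm w)"
      proof -
        have "norm (transpose Z *v (V *v (diag_mat lam *v a))) \<le> norm (diag_mat lam *v a)"
          using norm_transpose_orthonormal_le[OF Z] orthonormal_columns_norm[OF V] by metis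
        also have "\<dots> \<le> spectral_norm E * norm a"
          using lamE lam_pos by (intro norm_diag_mat_le) (simp add: less_imp_le)
        also have "\<dots> \<le> spectral_norm E * (s * norm w)"
          using a by (simp add: mult_left_mono spectral_norm_nonneg)
        finally show ?thesis .
      qed
      moreover have "norm (transpose Z *v (Vp *v (diag_mat lamp *v b))) \<le> L * (s * norm w)"
      proof -
        \<comment> \<open>The factor \<open>s\<close> arises because the vector under
          \<open>transpose Z\<close> is orthogonal to the columns of \<open>V\<close>: the distance
          bound again, with exchanged roles.\<close>
        have "norm (transpose Z *v (Vp *v (diag_mat lamp *v b))) \<le> s * norm (diag_mat lamp *v b)"
          using norm_transpose_le_subspace_dist[OF Z VVp]
          by (simp add: s_def subspace_dist_commute[of V] orthonormal_columns_norm[OF Vp])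
        also have "norm (diag_mat lamp *v b) \<le> L * norm b"
          using L lamp_pos by (intro norm_diag_mat_le) (simp add: less_imp_le)
        also have "L * norm b \<le> L * norm w"
          using b L0 by simp
        finally show ?thesis
          using s0 by (simp add: mult_left_mono mult.left_commute)
      qed
      ultimately have "norm g \<le> ?c * (s * norm w)"
        unfolding distrib_right by linarith
      \<comment> \<open>Passing from sine to tangent produces the shape of
        \<open>\<epsilon>\<close>.\<close>
      also have "\<dots> \<le> ?c * (tan \<theta> * norm w)"
        using tan c0 by (intro mult_left_mono mult_right_mono) auto
      finally have "(norm g)\<^sup>2 \<le> ?c\<^sup>2 * (tan \<theta>)\<^sup>2 * (w \<bullet> w)"
        using power_mono[of "norm g" "?c * (tan \<theta> * norm w)" 2]
        by (simp add: power_mult_distrib power2_norm_eq_inner mult_ac)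
      then have "spectral_norm F * (norm g)\<^sup>2 \<le> spectral_norm F * (?c\<^sup>2 * (tan \<theta>)\<^sup>2 * (w \<bullet> w))"
        by (simp add: mult_left_mono spectral_norm_nonneg)
      also have "\<dots> = (\<epsilon> - \<eta>) * (w \<bullet> w)"
        by (simp add: assms(11) F_def L_def)
      finally have "spectral_norm F * (norm g)\<^sup>2 \<le> (\<epsilon> - \<eta>) * (w \<bullet> w)" .
      moreover have "g \<bullet> (F *v g) \<le> norm g * (spectral_norm F * norm g)"
        using norm_cauchy_schwarz norm_matrix_vector_mult_le
        by (meson mult_left_mono norm_ge_zero order_trans)
      ultimately show ?thesis
        by (simp add: power2_eq_square mult_ac)
    qed
    ultimately have "(l - \<epsilon>) * (w \<bullet> w) \<le> Re \<mu> * (w \<bullet> w)"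
      using \<mu> by (simp add: left_diff_distrib)
    then show ?thesis using ww upper by simp
  qed
  then show "\<mu> \<in> \<real> \<and> min 1 (lambda_min (diag_mat lamp) - \<epsilon>) \<le> Re \<mu> \<and>
      Re \<mu> \<le> max 1 (lambda_max (diag_mat lamp) + \<eta>)"
    using reduced(1) unfolding L_def l_def by (cases "\<mu> = 1") auto
qed

end
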